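(* Let $(\Pi_n,X_n)$ be a Nash equilibrium of the reduced game $\overline{G}_n(\mu)$, and let $(\overline{p}_q)_{q=1,\dots,n}$, $\overline p_q=\overline p_q(u_1,\dots,u_{q-1})$, be the corresponding pure strategy of player 2 (the price process), i.e. $X_n(\omega)=\frac{1}{\sqrt n}\sum_{q=1}^n u_q\,\overline p_q(u_1,\dots,u_{q-1})$. Then $\lambda_n$ is the unique probability on $\Omega_n$ that makes the price process $(\overline{p}_q)_{q=1,\dots,n}$ a martingale (with respect to the filtration $(\sigma(u_1,\dots,u_{q-1}))_{q=1,\dots,n}$).
   Context: Standing assumptions. (A1) $\mu$ is a probability measure on $[0,1]$, absolutely continuous with respect to Lebesgue measure, with strictly positive $C^1$ density $f_\mu$ on $[0,1]$. (A2) $H:\mathbb{R}\to\mathbb{R}$ is strictly increasing, strictly convex and $C^2$, $H'$ is Lipschitz-continuous, and there are constants $\epsilon,K>0$ with $\epsilon<H'(x)<K$ for all $x\in\mathbb{R}$. Notation. $n\ge 1$; $\Omega_n=\{-1,+1\}^n$, $\omega=(u_1,\dots,u_n)\in\Omega_n$; $\lambda_n$ is the uniform probability on $\Omega_n$; $S_n(\omega)=\frac{1}{\sqrt n}\sum_{q=1}^n u_q$. Reduced game $\overline{G}_n(\mu)$ (trading game in which nature draws $L\sim\mu$, observed only by player 1; at each stage $q$ player 1 chooses $u_q=\pm1$ without observing player 2's actions, and player 2 chooses deterministically a price as a function of past moves of player 1). A strategy of player 1 is identified with a probability $\Pi$ on pairs $(\omega,L)\in\Omega_n\times\mathbb{R}$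 whose marginal on $L$ is $\mu$. A (pure) strategy of player 2 is a sequence $\overline p=(\overline p_1,\dots,\overline p_n)$ with $\overline p_q:\{-1,+1\}^{q-1}\to\mathbb{R}$; it is identified with the function $X_{n,\overline p}(\omega)=\frac{1}{\sqrt n}\sum_{q=1}^n u_q\,\overline p_q(u_1,\dots,u_{q-1})$ on $\Omega_n$, which determines $\overline p$ uniquely. $\mathbb{X}_n$ denotes the set of all such functions. Payoffs: $g_1(\Pi,X)=E_\Pi[LS_n-X]$ (maximized by player 1) and $g_2(\Pi,X)=E_\Pi[H(LS_n-X)]$ (minimized by player 2). A Nash equilibrium is a pair $(\Pi,X)$ such that $\Pi$ maximizes $g_1(\cdot,X)$ and $X$ minimizes $g_2(\Pi,\cdot)$ over $\mathbb{X}_n$.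
   Formalization: Uniqueness is proved on σ(u_1,…,u_{n−1}) only: the prices and the filtration do not involve u_n, so literal uniqueness on Ω_n fails (for n=1 the price is constant and every probability on {−1,+1} makes it a martingale). *)

theory Defs
  imports "HOL-Probability.Probability"
begin

text \<open>
  A path \<open>(u\<^sub>1, \<dots>, u\<^sub>n)\<close> of player 1's moves is a list of length \<open>n\<close>. Lists are indexed from 0, so
  \<open>u\<^sub>q\<close> is \<open>w ! (q - 1)\<close> and the history \<open>(u\<^sub>1, \<dots>, u\<^sub>q\<^sub>-\<^sub>1)\<close> is \<open>take (q - 1) w\<close>, for \<open>1 \<le> q \<le> n\<close>.
\<close>

definition Omega :: "nat \<Rightarrow> real list set" where
  "Omega n = {w. length w = n \<and> set w \<subseteq> {-1, 1}}"

definition lambda_n :: "nat \<Rightarrow> real list measure" where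
  "lambda_n n = uniform_count_measure (Omega n)"

definition S :: "nat \<Rightarrow> real list \<Rightarrow> real" where
  "S n w = (\<Sum>q = 1..n. w ! (q - 1)) / sqrt (real n)"

definition law_assumption :: "real measure \<Rightarrow> bool" where
  "law_assumption \<mu> \<longleftrightarrow> prob_space \<mu> \<and>
     (\<exists>f f'. \<mu> = density lborel (\<lambda>x. ennreal (indicator {0..1} x * f x)) \<and>
        (\<forall>x\<in>{0..1}. 0 < f x) \<and>
        (\<forall>x\<in>{0..1}. (f has_real_derivative f' x) (at x within {0..1})) \<and>
        continuous_on {0..1} f')"

definition strictly_convex :: "(real \<Rightarrow> real) \<Rightarrow> bool" where
  "strictly_convex h \<longleftrightarrow>
     (\<forall>x y t. x \<noteq> y \<and> 0 < t \<and> t < 1 \<longrightarrow>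
        h ((1 - t) * x + t * y) < (1 - t) * h x + t * h y)"

definition risk_assumption :: "(real \<Rightarrow> real) \<Rightarrow> bool" where
  "risk_assumption H \<longleftrightarrow> strict_mono H \<and> strictly_convex H \<and>
     (\<exists>H' H''. (\<forall>x. (H has_real_derivative H' x) (at x)) \<and>
        (\<forall>x. (H' has_real_derivative H'' x) (at x)) \<and> continuous_on UNIV H'' \<and>
        (\<exists>C. C-lipschitz_on UNIV H') \<and>
        (\<exists>\<epsilon> K. 0 < \<epsilon> \<and> 0 < K \<and> (\<forall>x. \<epsilon> < H' x \<and> H' x < K)))"

text \<open>
  The function \<open>p q\<close> gives the price at stage \<open>q\<close>. Only its values on lists over \<open>{-1, 1}\<close> of length
  \<open>q - 1\<close> matter, for \<open>1 \<le> q \<le> n\<close>; likewise a function on \<open>Omega n\<close> is a total function whose values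
  outside \<open>Omega n\<close> are irrelevant.
\<close>

definition price :: "(nat \<Rightarrow> real list \<Rightarrow> real) \<Rightarrow> nat \<Rightarrow> real list \<Rightarrow> real" where
  "price p q w = p q (take (q - 1) w)"

definition X_of :: "nat \<Rightarrow> (nat \<Rightarrow> real list \<Rightarrow> real) \<Rightarrow> real list \<Rightarrow> real" where
  "X_of n p w = (\<Sum>q = 1..n. w ! (q - 1) * price p q w) / sqrt (real n)"

definition X_space :: "nat \<Rightarrow> (real list \<Rightarrow> real) set" where
  "X_space n = {X. \<exists>p. \<forall>w\<in>Omega n. X w = X_of n p w}"

definition strategies1 :: "nat \<Rightarrow> real measure \<Rightarrow> (real list \<times> real) measure set" where
  "strategies1 n \<mu> = {P. prob_space P \<and>
     sets P = sets (count_space (Omega n) \<Otimes>\<^sub>M borel) \<and> distr P borel snd = \<mu>}"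

definition g1 :: "nat \<Rightarrow> (real list \<times> real) measure \<Rightarrow> (real list \<Rightarrow> real) \<Rightarrow> real" where
  "g1 n P X = (\<integral>(w, L). L * S n w - X w \<partial>P)"

definition g2 ::
  "nat \<Rightarrow> (real \<Rightarrow> real) \<Rightarrow> (real list \<times> real) measure \<Rightarrow> (real list \<Rightarrow> real) \<Rightarrow> real" where
  "g2 n H P X = (\<integral>(w, L). H (L * S n w - X w) \<partial>P)"

definition nash_equilibrium :: "nat \<Rightarrow> real measure \<Rightarrow> (real \<Rightarrow> real) \<Rightarrow>
    (real list \<times> real) measure \<Rightarrow> (real list \<Rightarrow> real) \<Rightarrow> bool" where
  "nash_equilibrium n \<mu> H P X \<longleftrightarrow> P \<in> strategies1 n \<mu> \<and> X \<in> X_space n \<and>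
     (\<forall>P'\<in>strategies1 n \<mu>. g1 n P' X \<le> g1 n P X) \<and>
     (\<forall>X'\<in>X_space n. g2 n H P X \<le> g2 n H P X')"

text \<open>
  The preimages under the map \<open>w \<mapsto> take (q - 1) w\<close> form the \<open>\<sigma>\<close>-algebra generated by
  \<open>u\<^sub>1, \<dots>, u\<^sub>q\<^sub>-\<^sub>1\<close> on \<open>Omega n\<close>. Neither the prices nor the \<open>\<sigma>\<close>-algebras up to \<open>hist_algebra n n\<close>
  involve \<open>u\<^sub>n\<close>, so being a martingale measure for the prices only constrains a probability on
  \<open>Omega n\<close> through its values on \<open>hist_algebra n n\<close>; this is where uniqueness can hold.
\<close>

definition hist_algebra :: "nat \<Rightarrow> nat \<Rightarrow> real list measure" where
  "hist_algebra n q = vimage_algebra (Omega n) (take (q - 1)) (count_space UNIV)"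

definition prob_on_Omega :: "nat \<Rightarrow> real list measure \<Rightarrow> bool" where
  "prob_on_Omega n Q \<longleftrightarrow> prob_space Q \<and> space Q = Omega n \<and> sets Q = Pow (Omega n)"

definition martingale_upto ::
  "nat \<Rightarrow> 'a measure \<Rightarrow> (nat \<Rightarrow> 'a measure) \<Rightarrow> (nat \<Rightarrow> 'a \<Rightarrow> real) \<Rightarrow> bool" where
  "martingale_upto n M F Y \<longleftrightarrow>
     filtration (space M) F \<and>
     (\<forall>q\<in>{1..n}. subalgebra M (F q) \<and> Y q \<in> borel_measurable (F q) \<and> integrable M (Y q)) \<and>
     (\<forall>q\<in>{1..n}. \<forall>r\<in>{q..n}. AE w in M. real_cond_exp M (F q) (Y r) w = Y q w)"

end

theory Submission
  imports Defs
begin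

text \<open>
  At an equilibrium player 1 must play every path with positive probability. Otherwise some path
  \<open>w0\<close> is missed, and player 2 can add to his prices a doubling strategy against \<open>w0\<close>: it gains
  \<open>1\<close> on every other path and pays for this only on \<open>w0\<close>. Almost surely his loss
  \<open>L * S n w - X w\<close> would then drop by \<open>1\<close>, which strictly lowers \<open>g2\<close> because \<open>H\<close> is strictly increasing
  (\<open>equilibrium_full_support\<close>).

  Player 1, for his part, puts no mass on pairs \<open>(w, L)\<close> where \<open>w\<close> does not maximize
  \<open>L * S n w - X w\<close> (\<open>equilibrium_AE_best_reply\<close>). As \<open>\<mu>\<close> has no atoms, the two facts together
  make every path a maximizer for at least two distinct values of \<open>L\<close>
  (\<open>equilibrium_two_values\<close>). One value shows that \<open>X\<close> depends on a path through its sum only: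
  of two paths with the same sum, neither can be dearer than the other. Two values show
  that \<open>X\<close> is a strictly convex function of that sum: the increments of \<open>X\<close> on both sides of a
  grid point are separated by two different multiples of the grid step.

  These two properties pass to the prices. Since the last moves \<open>+-\<close> and \<open>-+\<close> lead to the same
  gain, the price after a history \<open>v\<close> is the average of the prices after \<open>v+\<close> and \<open>v-\<close>
  (\<open>exchangeable_imp_averaging\<close>), so the price process is a martingale under fair coin tossing.
  By strict convexity the price after \<open>v+\<close> exceeds the price after \<open>v-\<close>
  (\<open>convex_imp_strictly_increasing\<close>). Hence any martingale measure has to split the mass of each
  cylinder into two equal halves as long as a later price depends on the move, that is for the
  first \<open>n - 1\<close> moves, and it coincides with \<open>lambda_n n\<close> on \<open>hist_algebra n n\<close>.
\<close>

section \<open>Paths and gains\<close>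

lemma finite_Omega: "finite (Omega n)"
  using finite_lists_length_eq[of "{-1, 1::real}" n] unfolding Omega_def by (simp add: conj_commute)

lemma Omega_snoc [simp]: "v @ [u] \<in> Omega (Suc m) \<longleftrightarrow> v \<in> Omega m \<and> u \<in> {-1, 1}"
  by (auto simp: Omega_def)

lemma length_Omega: "w \<in> Omega n \<Longrightarrow> length w = n"
  by (simp add: Omega_def)

lemma nth_Omega: "w \<in> Omega n \<Longrightarrow> i < n \<Longrightarrow> w ! i \<in> {-1, 1}"
  unfolding Omega_def using nth_mem[of i w] by blast

lemma take_Omega: "w \<in> Omega n \<Longrightarrow> m \<le> n \<Longrightarrow> take m w \<in> Omega m"
  unfolding Omega_def using set_take_subset[of m w] by auto

lemma Omega_nonempty: "Omega n \<noteq> {}"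
proof -
  have "replicate n 1 \<in> Omega n" by (auto simp: Omega_def)
  then show ?thesis by blast
qed

lemma S_eq_sum_list:
  assumes "length w = n" shows "S n w = sum_list w / sqrt (real n)"
  using assms by (simp add: S_def sum.atLeast1_atMost_eq sum_list_sum_nth atLeast0LessThan)

text \<open>
  The gain carries no factor \<open>1 / sqrt n\<close>, so that the gains of different horizons \<open>m\<close> along
  one path fit together. It is \<open>sqrt n\<close> times the conditional expectation of \<open>X\<close> given the
  first \<open>m\<close> moves, under fair coin tossing.
\<close>

definition gain :: "(nat \<Rightarrow> real list \<Rightarrow> real) \<Rightarrow> nat \<Rightarrow> real list \<Rightarrow> real" where
  "gain p m v = (\<Sum>i<m. v ! i * p (Suc i) (take i v))"

lemma gain_snoc:
  assumes "length v = m"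
  shows "gain p (Suc m) (v @ [u]) = gain p m v + u * p (Suc m) v"
  using assms by (simp add: gain_def nth_append)

lemma X_of_eq_gain: "X_of n p w = gain p n w / sqrt (real n)"
  by (simp add: X_of_def gain_def price_def sum.atLeast1_atMost_eq)

lemma X_of_add: "X_of n (\<lambda>q h. p q h + p' q h) w = X_of n p w + X_of n p' w"
  by (simp add: X_of_def price_def algebra_simps sum.distrib add_divide_distrib)

section \<open>The doubling strategy against a path\<close>

text \<open>
  As long as player 1 follows \<open>w0\<close>, bet on a deviation at the next move and double the stake;
  stop betting once he has deviated.
\<close>

definition doubling :: "real list \<Rightarrow> nat \<Rightarrow> real list \<Rightarrow> real" where
  "doubling w0 q h = (if h = take (q - 1) w0 then - (w0 ! (q - 1)) * 2 ^ (q - 1) else 0)"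

text \<open>
  If the first deviation occurs at position \<open>k\<close>, the stakes lost before it add up to \<open>2 ^ k - 1\<close>,
  one less than the stake \<open>2 ^ k\<close> won there.
\<close>

lemma gain_doubling:
  assumes "w \<in> Omega n" "w0 \<in> Omega n" "m \<le> n"
  shows "gain (doubling w0) m w = (if take m w = take m w0 then 1 - 2 ^ m else 1)"
  using assms(3)
proof (induction m)
  case 0
  then show ?case by (simp add: gain_def)
next
  case (Suc m)
  have len: "m < length w" "m < length w0"
    using assms Suc.prems by (auto simp: length_Omega)
  have step: "gain (doubling w0) (Suc m) w
      = gain (doubling w0) m w + w ! m * (if take m w = take m w0 then - (w0 ! m) * 2 ^ m else 0)"
    by (simp add: gain_def doubling_def[of w0 "Suc m"])
  have "w ! m \<in> {-1, 1}" "w0 ! m \<in> {-1, 1}"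
    using assms Suc.prems nth_Omega[of w n m] nth_Omega[of w0 n m] by auto
  with Suc len show ?case
    unfolding step by (auto simp: take_Suc_conv_app_nth)
qed

lemma hedge_off_one_path:
  assumes "n \<ge> 1" "w0 \<in> Omega n"
  shows "\<exists>p'. \<forall>w\<in>Omega n. w \<noteq> w0 \<longrightarrow> X_of n p' w = 1"
proof (intro exI ballI impI)
  fix w assume w: "w \<in> Omega n" "w \<noteq> w0"
  have "gain (\<lambda>q h. sqrt n * doubling w0 q h) n w = sqrt n * gain (doubling w0) n w"
    by (simp add: gain_def sum_distrib_left mult_ac)
  also have "gain (doubling w0) n w = 1"
    using gain_doubling[OF w(1) assms(2), of n] w assms by (simp add: length_Omega)
  finally show "X_of n (\<lambda>q h. sqrt n * doubling w0 q h) w = 1"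
    using assms(1) by (simp add: X_of_eq_gain)
qed

section \<open>Integrability of the payoffs\<close>

lemma law_AE_unit_interval_no_atom:
  assumes "law_assumption \<mu>"
  shows "AE x in \<mu>. x \<in> {0..1} \<and> x \<noteq> c"
proof -
  obtain f f' where mu: "\<mu> = density lborel (\<lambda>x. ennreal (indicator {0..1} x * f x))"
    and d: "\<forall>x\<in>{0..1}. (f has_real_derivative f' x) (at x within {0..1})"
    using assms unfolding law_assumption_def by auto
  have "continuous_on {0..1} f" using d by (meson DERIV_continuous_on)
  then have m: "(\<lambda>x. indicator {0..1} x * f x) \<in> borel_measurable borel"
    using borel_measurable_continuous_on_indicator[of "{0..1}" f] by simp
  have *: "AE x in lborel. 0 < ennreal (indicator {0..1} x * f x) \<longrightarrow> x \<in> {0..1} \<and> x \<noteq> c"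
    using AE_lborel_singleton[of c] by eventually_elim (auto split: split_indicator_asm)
  show ?thesis unfolding mu
    by (subst AE_density) (use m * in auto)
qed

lemma strategy_AE_value:
  assumes "law_assumption \<mu>" "P \<in> strategies1 n \<mu>"
  shows "AE z in P. snd z \<in> {0..1} \<and> snd z \<noteq> c"
proof -
  have [measurable_cong]: "sets P = sets (count_space (Omega n) \<Otimes>\<^sub>M borel)"
    and mu: "\<mu> = distr P borel snd"
    using assms(2) by (auto simp: strategies1_def)
  have "AE x in distr P borel snd. x \<in> {0..1} \<and> x \<noteq> c"
    using law_AE_unit_interval_no_atom[OF assms(1), of c] unfolding mu .
  then show ?thesis
    by (subst (asm) AE_distr_iff) auto
qed

lemma strategy_AE_path:
  assumes "P \<in> strategies1 n \<mu>" shows "AE z in P. fst z \<in> Omega n"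
proof -
  have "sets P = sets (count_space (Omega n) \<Otimes>\<^sub>M borel)"
    using assms by (auto simp: strategies1_def)
  then have "space P = Omega n \<times> UNIV"
    using sets_eq_imp_space_eq[of P] by (simp add: space_pair_measure)
  then show ?thesis by (intro AE_I2) auto
qed

lemma payoff_measurable:
  fixes X :: "real list \<Rightarrow> real"
  shows "(\<lambda>z. snd z * S n (fst z) - X (fst z)) \<in> borel_measurable (count_space (Omega n) \<Otimes>\<^sub>M borel)"
proof -
  have [measurable]: "S n \<in> borel_measurable (count_space (Omega n))"
    "X \<in> borel_measurable (count_space (Omega n))"
    by (simp_all add: measurable_count_space_eq1)
  show ?thesis by measurable
qed

lemma strategy_payoff_measurable:
  assumes "P \<in> strategies1 n \<mu>"
  shows "(\<lambda>z. snd z * S n (fst z) - X (fst z)) \<in> borel_measurable P"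
  using payoff_measurable[of n X] assms measurable_cong_sets[of P "count_space (Omega n) \<Otimes>\<^sub>M borel" borel borel]
  by (auto simp: strategies1_def)

lemma payoff_bounded:
  assumes "law_assumption \<mu>" "P \<in> strategies1 n \<mu>"
  obtains M where "AE z in P. \<bar>snd z * S n (fst z) - X (fst z)\<bar> \<le> M"
proof
  show "AE z in P. \<bar>snd z * S n (fst z) - X (fst z)\<bar> \<le> (\<Sum>w\<in>Omega n. \<bar>S n w\<bar> + \<bar>X w\<bar>)"
    using strategy_AE_value[OF assms, of 0] strategy_AE_path[OF assms(2)]
  proof eventually_elim
    case (elim z)
    have "\<bar>snd z * S n (fst z)\<bar> \<le> 1 * \<bar>S n (fst z)\<bar>"
      unfolding abs_mult using elim by (intro mult_right_mono) auto
    then have "\<bar>snd z * S n (fst z) - X (fst z)\<bar> \<le> \<bar>S n (fst z)\<bar> + \<bar>X (fst z)\<bar>"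
      by linarith
    also have "\<dots> \<le> (\<Sum>w\<in>Omega n. \<bar>S n w\<bar> + \<bar>X w\<bar>)"
      using elim finite_Omega by (intro member_le_sum) auto
    finally show ?case .
  qed
qed

lemma payoff_integrable:
  assumes "law_assumption \<mu>" "P \<in> strategies1 n \<mu>"
  shows "integrable P (\<lambda>z. snd z * S n (fst z) - X (fst z))"
proof -
  interpret prob_space P using assms(2) by (simp add: strategies1_def)
  obtain M where "AE z in P. \<bar>snd z * S n (fst z) - X (fst z)\<bar> \<le> M"
    using payoff_bounded[OF assms] .
  then show ?thesis
    by (intro integrable_const_bound[of _ M] strategy_payoff_measurable[OF assms(2)]) auto
qed

lemma utility_integrable:
  fixes H :: "real \<Rightarrow> real"
  assumes "law_assumption \<mu>" "P \<in> strategies1 n \<mu>" "mono H"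
  shows "integrable P (\<lambda>z. H (snd z * S n (fst z) - X (fst z)))"
proof -
  interpret prob_space P using assms(2) by (simp add: strategies1_def)
  obtain M where M: "AE z in P. \<bar>snd z * S n (fst z) - X (fst z)\<bar> \<le> M"
    using payoff_bounded[OF assms(1,2)] .
  have "H \<in> borel_measurable borel"
    using assms(3) by (rule borel_measurable_mono)
  then have meas: "(\<lambda>z. H (snd z * S n (fst z) - X (fst z))) \<in> borel_measurable P"
    using strategy_payoff_measurable[OF assms(2)] by (rule measurable_compose[rotated])
  from M have "AE z in P. norm (H (snd z * S n (fst z) - X (fst z))) \<le> \<bar>H M\<bar> + \<bar>H (- M)\<bar>"
  proof eventually_elim
    case (elim z)
    have "H (- M) \<le> H (snd z * S n (fst z) - X (fst z))"
      "H (snd z * S n (fst z) - X (fst z)) \<le> H M"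
      using elim by (auto intro!: monoD[OF assms(3)])
    then show ?case by simp
  qed
  then show ?thesis
    using meas by (rule integrable_const_bound)
qed

section \<open>Optimality of both players\<close>

text \<open>
  The contradiction comes from the deviation \<open>X'\<close>, which hedges with the doubling strategy
  against the path that is never played.
\<close>

lemma equilibrium_full_support:
  assumes "n \<ge> 1" "law_assumption \<mu>" "strict_mono H"
    and "nash_equilibrium n \<mu> H P X" "w0 \<in> Omega n"
  shows "\<not> (AE z in P. fst z \<noteq> w0)"
proof
  assume null: "AE z in P. fst z \<noteq> w0"
  have P: "P \<in> strategies1 n \<mu>" and opt: "\<And>X'. X' \<in> X_space n \<Longrightarrow> g2 n H P X \<le> g2 n H P X'"
    using assms(4) by (auto simp: nash_equilibrium_def)
  interpret prob_space P using P by (simp add: strategies1_def)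
  obtain p where p: "\<And>w. w \<in> Omega n \<Longrightarrow> X w = X_of n p w"
    using assms(4) by (auto simp: nash_equilibrium_def X_space_def)
  obtain p' where p': "\<And>w. w \<in> Omega n \<Longrightarrow> w \<noteq> w0 \<Longrightarrow> X_of n p' w = 1"
    using hedge_off_one_path[OF assms(1,5)] by blast
  define X' where "X' = X_of n (\<lambda>q h. p q h + p' q h)"
  have "X' \<in> X_space n"
    unfolding X_space_def X'_def by blast
  have less: "AE z in P. H (snd z * S n (fst z) - X' (fst z)) < H (snd z * S n (fst z) - X (fst z))"
    using null strategy_AE_path[OF P]
  proof eventually_elim
    case (elim z)
    then have "X' (fst z) = X (fst z) + 1"
      by (simp add: X'_def X_of_add p p')
    then show ?case
      using assms(3) by (simp add: strict_mono_less)
  qed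
  have "g2 n H P X' < g2 n H P X"
    unfolding g2_def case_prod_beta
    using utility_integrable[OF assms(2) P strict_mono_mono[OF assms(3)]] less
    by (intro integral_less_AE_space) (auto simp: emeasure_space_1)
  with opt[OF \<open>X' \<in> X_space n\<close>] show False by simp
qed

text \<open>
  The deviation \<open>T\<close> replaces the chosen path by \<open>w1\<close> exactly where this is an improvement. It does
  not touch \<open>L\<close>, so it yields an admissible strategy; as its pointwise improvement cannot have
  positive expectation, it vanishes almost surely. Comparing with one fixed path at a time avoids
  a measurable selection of maximizers.
\<close>

lemma equilibrium_AE_best_reply:
  assumes "law_assumption \<mu>" "nash_equilibrium n \<mu> H P X" "w1 \<in> Omega n"
  shows "AE z in P. snd z * S n w1 - X w1 \<le> snd z * S n (fst z) - X (fst z)"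
proof -
  have P: "P \<in> strategies1 n \<mu>" and opt: "\<And>P'. P' \<in> strategies1 n \<mu> \<Longrightarrow> g1 n P' X \<le> g1 n P X"
    using assms(2) by (auto simp: nash_equilibrium_def)
  interpret prob_space P using P by (simp add: strategies1_def)
  define N where "N = count_space (Omega n) \<Otimes>\<^sub>M (borel :: real measure)"
  have [measurable_cong]: "sets P = sets N" and mu: "\<mu> = distr P borel snd"
    using P by (auto simp: strategies1_def N_def)
  define f where "f z = snd z * S n (fst z) - X (fst z)" for z :: "real list \<times> real"
  define T where "T z = (if f z < snd z * S n w1 - X w1 then (w1, snd z) else z)" for z
  have f [measurable]: "f \<in> borel_measurable N"
    unfolding f_def N_def by (rule payoff_measurable)
  have snd [measurable]: "snd \<in> borel_measurable N"
    unfolding N_def by measurable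
  have "(\<lambda>z. (w1, snd z)) \<in> N \<rightarrow>\<^sub>M N"
    using assms(3) snd unfolding N_def by (intro measurable_Pair) auto
  then have T [measurable]: "T \<in> P \<rightarrow>\<^sub>M N"
    unfolding T_def by measurable
  have dist: "distr P N T \<in> strategies1 n \<mu>"
  proof -
    have "distr (distr P N T) borel snd = distr P borel (snd \<circ> T)"
      by (rule distr_distr) auto
    also have "snd \<circ> T = snd" by (auto simp: T_def)
    finally show ?thesis
      using prob_space_distr[OF T] mu by (auto simp: strategies1_def N_def)
  qed
  have "g1 n (distr P N T) X \<le> g1 n P X" using dist by (rule opt)
  also have "g1 n (distr P N T) X = (\<integral>z. f (T z) \<partial>P)"
    unfolding g1_def case_prod_beta f_def[symmetric] by (rule integral_distr) auto
  also have "g1 n P X = (\<integral>z. f z \<partial>P)"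
    unfolding g1_def case_prod_beta f_def ..
  finally have le: "(\<integral>z. f (T z) \<partial>P) \<le> (\<integral>z. f z \<partial>P)" .
  have int: "integrable P f"
    unfolding f_def using payoff_integrable[OF assms(1) P] .
  have intT: "integrable P (\<lambda>z. f (T z))"
    using payoff_integrable[OF assms(1) dist, of X]
    unfolding f_def[symmetric] by (rule integrable_distr[OF T])
  have ge: "f z \<le> f (T z)" for z
    by (simp add: T_def f_def)
  have "(\<integral>z. f (T z) - f z \<partial>P) = 0"
    using le int intT ge by (intro antisym integral_nonneg_AE) auto
  then have "AE z in P. f (T z) - f z = 0"
    using integral_nonneg_eq_0_iff_AE[of P "\<lambda>z. f (T z) - f z"] int intT ge by simp
  then show ?thesis
    by eventually_elim (auto simp: T_def f_def split: if_splits)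
qed

text \<open>
  The four properties below are the link between the equilibrium and the martingale question:
  the first two describe the final gain, the last two the price tree. A history of length \<open>m\<close>
  is the one that the price of stage \<open>Suc m\<close> depends on.
\<close>

definition exchangeable_gain :: "nat \<Rightarrow> (nat \<Rightarrow> real list \<Rightarrow> real) \<Rightarrow> bool" where
  "exchangeable_gain n p \<longleftrightarrow>
     (\<forall>w\<in>Omega n. \<forall>w'\<in>Omega n. sum_list w = sum_list w' \<longrightarrow> gain p n w = gain p n w')"

definition strictly_convex_gain :: "nat \<Rightarrow> (nat \<Rightarrow> real list \<Rightarrow> real) \<Rightarrow> bool" where
  "strictly_convex_gain n p \<longleftrightarrow>
     (\<forall>w\<in>Omega n. \<forall>w1\<in>Omega n. \<forall>w2\<in>Omega n. \<forall>d>0.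
        sum_list w1 = sum_list w - d \<longrightarrow> sum_list w2 = sum_list w + d \<longrightarrow>
        2 * gain p n w < gain p n w1 + gain p n w2)"

definition averaging :: "nat \<Rightarrow> (nat \<Rightarrow> real list \<Rightarrow> real) \<Rightarrow> bool" where
  "averaging n p \<longleftrightarrow> (\<forall>m v. Suc m < n \<longrightarrow> v \<in> Omega m \<longrightarrow>
     p (Suc (Suc m)) (v @ [1]) + p (Suc (Suc m)) (v @ [-1]) = 2 * p (Suc m) v)"

definition strictly_increasing :: "nat \<Rightarrow> (nat \<Rightarrow> real list \<Rightarrow> real) \<Rightarrow> bool" where
  "strictly_increasing n p \<longleftrightarrow> (\<forall>m v. Suc m < n \<longrightarrow> v \<in> Omega m \<longrightarrow>
     p (Suc (Suc m)) (v @ [-1]) < p (Suc (Suc m)) (v @ [1]))"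

text \<open>
  If \<open>w0\<close> were optimal at most for \<open>L = c\<close>, then almost surely player 1 would not choose it,
  the value \<open>c\<close> having probability zero.
\<close>

lemma equilibrium_two_values:
  assumes "n \<ge> 1" "law_assumption \<mu>" "strict_mono H"
    and "nash_equilibrium n \<mu> H P X" "w0 \<in> Omega n"
  shows "\<exists>L. L \<noteq> c \<and> (\<forall>w\<in>Omega n. L * S n w - X w \<le> L * S n w0 - X w0)"
proof (rule ccontr)
  assume none: "\<not> ?thesis"
  have P: "P \<in> strategies1 n \<mu>" using assms(4) by (simp add: nash_equilibrium_def)
  have "AE z in P. \<forall>w\<in>Omega n. snd z * S n w - X w \<le> snd z * S n (fst z) - X (fst z)"
    using equilibrium_AE_best_reply[OF assms(2,4)] by (intro AE_finite_allI finite_Omega)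
  with strategy_AE_value[OF assms(2) P, of c] have "AE z in P. fst z \<noteq> w0"
    by eventually_elim (use none in auto)
  with equilibrium_full_support[OF assms] show False by simp
qed

text \<open>
  A path that is optimal for some \<open>L\<close> costs at most as much as any other path with the same sum.
\<close>

lemma equilibrium_exchangeable:
  assumes "n \<ge> 1" "law_assumption \<mu>" "strict_mono H" "nash_equilibrium n \<mu> H P X"
    and "\<forall>w\<in>Omega n. X w = X_of n p w"
  shows "exchangeable_gain n p"
  unfolding exchangeable_gain_def
proof (intro ballI impI)
  fix w w' assume w: "w \<in> Omega n" "w' \<in> Omega n" "sum_list w = sum_list w'"
  then have S: "S n w = S n w'"
    by (simp add: S_eq_sum_list length_Omega)
  obtain L where "L * S n w' - X w' \<le> L * S n w - X w"
    using equilibrium_two_values[OF assms(1-4) w(1)] w(2) by blast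
  moreover obtain L' where "L' * S n w - X w \<le> L' * S n w' - X w'"
    using equilibrium_two_values[OF assms(1-4) w(2)] w(1) by blast
  ultimately have "X w = X w'" using S by simp
  then show "gain p n w = gain p n w'"
    using assms(1,5) w by (simp add: X_of_eq_gain)
qed

text \<open>
  Optimality of \<open>w\<close> at \<open>L\<close> says that \<open>L * e\<close> lies between the increments of \<open>X\<close> to the left and
  to the right of \<open>w\<close>. Two distinct values of \<open>L\<close> keep these increments apart.
\<close>

lemma equilibrium_convex:
  assumes "n \<ge> 1" "law_assumption \<mu>" "strict_mono H" "nash_equilibrium n \<mu> H P X"
    and "\<forall>w\<in>Omega n. X w = X_of n p w"
  shows "strictly_convex_gain n p"
  unfolding strictly_convex_gain_def
proof (intro ballI allI impI)
  fix w w1 w2 and d :: real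
  assume w: "w \<in> Omega n" "w1 \<in> Omega n" "w2 \<in> Omega n"
    and d: "d > 0" "sum_list w1 = sum_list w - d" "sum_list w2 = sum_list w + d"
  define e where "e = d / sqrt n"
  have e: "e > 0" "S n w1 = S n w - e" "S n w2 = S n w + e"
    using assms(1) w d by (auto simp: e_def S_eq_sum_list length_Omega diff_divide_distrib add_divide_distrib)
  obtain L where L: "L * S n w1 - X w1 \<le> L * S n w - X w" "L * S n w2 - X w2 \<le> L * S n w - X w"
    using equilibrium_two_values[OF assms(1-4) w(1)] w by blast
  obtain L' where L': "L' \<noteq> L" "L' * S n w1 - X w1 \<le> L' * S n w - X w"
      "L' * S n w2 - X w2 \<le> L' * S n w - X w"
    using equilibrium_two_values[OF assms(1-4) w(1), of L] w by blast
  have "X w - X w1 \<le> L * e" "L * e \<le> X w2 - X w" "X w - X w1 \<le> L' * e" "L' * e \<le> X w2 - X w"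
    using L L' by (auto simp: e algebra_simps)
  moreover have "L * e \<noteq> L' * e" using L' e by simp
  ultimately have "2 * X w < X w1 + X w2" by linarith
  then have "2 * (gain p n w / sqrt n) < gain p n w1 / sqrt n + gain p n w2 / sqrt n"
    using assms(5) w by (simp add: X_of_eq_gain)
  then show "2 * gain p n w < gain p n w1 + gain p n w2"
    using assms(1) by (simp add: field_simps)
qed

section \<open>From gains to prices\<close>

text \<open>
  The gain at a history is the average of the gains at its two continuations, so the symmetry of
  the final gain is inherited by all earlier ones.
\<close>

lemma gain_exchangeable_upto:
  assumes exch: "exchangeable_gain n p"
    and "m \<le> n" "v \<in> Omega m" "v' \<in> Omega m" "sum_list v = sum_list v'"
  shows "gain p m v = gain p m v'"
  using assms(2-)
proof (induction m arbitrary: v v' rule: inc_induct)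
  case base
  with exch show ?case unfolding exchangeable_gain_def by blast
next
  case (step m)
  have "gain p (Suc m) (v @ [u]) = gain p (Suc m) (v' @ [u])" if "u \<in> {-1, 1}" for u
    using step.prems that by (intro step.IH) auto
  from this[of 1] this[of "-1"] show ?case
    using step.prems by (simp add: gain_snoc length_Omega)
qed

text \<open>
  The paths \<open>v+-\<close> and \<open>v-+\<close> gain \<open>p v - p (v+)\<close> and \<open>- p v + p (v-)\<close> after \<open>v\<close>, where the stage
  index is dropped; equality of the two is the averaging identity.
\<close>

lemma exchangeable_imp_averaging:
  assumes exch: "exchangeable_gain n p"
  shows "averaging n p"
  unfolding averaging_def
proof (intro allI impI)
  fix m v assume m: "Suc m < n" and v: "v \<in> Omega m"
  have "gain p (Suc (Suc m)) ((v @ [1]) @ [-1]) = gain p (Suc (Suc m)) ((v @ [-1]) @ [1])"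
    using m v by (intro gain_exchangeable_upto[OF exch]) (auto simp del: append_assoc)
  then show "p (Suc (Suc m)) (v @ [1]) + p (Suc (Suc m)) (v @ [-1]) = 2 * p (Suc m) v"
    using v by (simp add: gain_snoc length_Omega del: append_assoc)
qed

lemma price_exchangeable:
  assumes exch: "exchangeable_gain n p"
    and "m < n" "v \<in> Omega m" "v' \<in> Omega m" "sum_list v = sum_list v'"
  shows "p (Suc m) v = p (Suc m) v'"
proof -
  have "gain p (Suc m) (v @ [1]) = gain p (Suc m) (v' @ [1])"
    using assms by (intro gain_exchangeable_upto[OF exch]) auto
  moreover have "gain p m v = gain p m v'"
    using assms by (intro gain_exchangeable_upto[OF exch]) auto
  ultimately show ?thesis
    using assms by (simp add: gain_snoc length_Omega)
qed

text \<open>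
  At the last stage the two prices are half the increments of the final gain to the right and to
  the left of \<open>v+-\<close>. At an earlier stage each price is the average of two prices one stage later;
  these are strictly ordered by induction and share the middle term at \<open>v+-\<close> and \<open>v-+\<close>.
\<close>

lemma convex_imp_strictly_increasing:
  assumes exch: "exchangeable_gain n p" and conv: "strictly_convex_gain n p"
  shows "strictly_increasing n p"
  unfolding strictly_increasing_def
proof (intro allI impI)
  fix m v assume "Suc m < n" "v \<in> Omega m"
  then have "m \<le> n - 2" by simp
  then show "p (Suc (Suc m)) (v @ [-1]) < p (Suc (Suc m)) (v @ [1])"
    using \<open>v \<in> Omega m\<close>
  proof (induction m arbitrary: v rule: inc_induct)
    case base
    define k where "k = n - 2"
    have nk: "n = Suc (Suc k)" and v: "v \<in> Omega k"
      using \<open>Suc m < n\<close> base by (auto simp: k_def)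
    have "2 * gain p n ((v @ [1]) @ [-1]) < gain p n ((v @ [-1]) @ [-1]) + gain p n ((v @ [1]) @ [1])"
      using v by (intro conv[unfolded strictly_convex_gain_def, rule_format, where d = 2])
        (auto simp: nk simp del: append_assoc)
    moreover have "gain p n ((v @ [1]) @ [-1]) = gain p n ((v @ [-1]) @ [1])"
      using v by (intro exch[unfolded exchangeable_gain_def, rule_format])
        (auto simp: nk simp del: append_assoc)
    ultimately show ?case
      using v unfolding k_def[symmetric] nk
      by (simp add: gain_snoc length_Omega del: append_assoc)
  next
    case (step m)
    let ?q = "Suc (Suc (Suc m))"
    have v: "v @ [1] \<in> Omega (Suc m)" "v @ [-1] \<in> Omega (Suc m)" using step.prems by auto
    have "p ?q ((v @ [1]) @ [-1]) < p ?q ((v @ [1]) @ [1])"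
      "p ?q ((v @ [-1]) @ [-1]) < p ?q ((v @ [-1]) @ [1])"
      using step.IH v by blast+
    moreover have "p ?q ((v @ [1]) @ [1]) + p ?q ((v @ [1]) @ [-1]) = 2 * p (Suc (Suc m)) (v @ [1])"
      "p ?q ((v @ [-1]) @ [1]) + p ?q ((v @ [-1]) @ [-1]) = 2 * p (Suc (Suc m)) (v @ [-1])"
      using exchangeable_imp_averaging[OF exch, unfolded averaging_def, rule_format, OF _ v(1)]
        exchangeable_imp_averaging[OF exch, unfolded averaging_def, rule_format, OF _ v(2)] step.hyps
      by (simp_all del: append_assoc)
    moreover have "p ?q ((v @ [1]) @ [-1]) = p ?q ((v @ [-1]) @ [1])"
      using step.prems step.hyps
      by (intro price_exchangeable[OF exch]) (auto simp del: append_assoc)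
    ultimately show ?case by linarith
  qed
qed

section \<open>History algebras and probabilities on paths\<close>

lemma sets_hist_algebra: "sets (hist_algebra n q) = {take (q - 1) -` B \<inter> Omega n | B. True}"
  unfolding hist_algebra_def by (subst sets_vimage_algebra2) auto

lemma space_hist_algebra: "space (hist_algebra n q) = Omega n"
  by (simp add: hist_algebra_def)

lemma sets_hist_algebra_mono:
  assumes "q \<le> r" shows "sets (hist_algebra n q) \<subseteq> sets (hist_algebra n r)"
proof
  fix A assume "A \<in> sets (hist_algebra n q)"
  then obtain B where B: "A = take (q - 1) -` B \<inter> Omega n" by (auto simp: sets_hist_algebra)
  have "take (q - 1) (take (r - 1) w) = take (q - 1) w" for w :: "real list"
    using assms by (simp add: min_def)
  then have "A = take (r - 1) -` (take (q - 1) -` B) \<inter> Omega n"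
    unfolding B by auto
  then show "A \<in> sets (hist_algebra n r)" unfolding sets_hist_algebra by blast
qed

lemma filtration_hist_algebra: "filtration (Omega n) (hist_algebra n)"
  by unfold_locales (simp_all add: space_hist_algebra sets_hist_algebra_mono)

lemma price_hist_measurable: "price p q \<in> borel_measurable (hist_algebra n q)"
proof -
  have "take (q - 1) \<in> hist_algebra n q \<rightarrow>\<^sub>M count_space UNIV"
    unfolding hist_algebra_def by (rule measurable_vimage_algebra1) auto
  then have "(\<lambda>w. p q (take (q - 1) w)) \<in> borel_measurable (hist_algebra n q)"
    by (rule measurable_compose) simp
  then show ?thesis by (simp add: price_def[abs_def])
qed

lemma subalgebra_hist_algebra:
  assumes "prob_on_Omega n Q" shows "subalgebra Q (hist_algebra n q)"
  using assms by (auto simp: subalgebra_def prob_on_Omega_def space_hist_algebra sets_hist_algebra)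

lemma prob_on_Omega_integrable:
  fixes f :: "real list \<Rightarrow> real"
  assumes "prob_on_Omega n Q" shows "integrable Q f"
proof -
  interpret prob_space Q using assms by (simp add: prob_on_Omega_def)
  have "f \<in> borel_measurable Q"
    using assms by (auto simp: prob_on_Omega_def measurable_def)
  moreover have "AE w in Q. norm (f w) \<le> (\<Sum>w\<in>Omega n. \<bar>f w\<bar>)"
    using assms by (intro AE_I2) (auto simp: prob_on_Omega_def intro!: member_le_sum finite_Omega)
  ultimately show ?thesis by (intro integrable_const_bound)
qed

lemma prob_on_Omega_set_integral:
  fixes f :: "real list \<Rightarrow> real"
  assumes "prob_on_Omega n Q" "A \<subseteq> Omega n"
  shows "set_lebesgue_integral Q A f = (\<Sum>w\<in>A. f w * measure Q {w})"
proof -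
  interpret prob_space Q using assms by (simp add: prob_on_Omega_def)
  have Q: "space Q = Omega n" "sets Q = Pow (Omega n)"
    using assms(1) by (auto simp: prob_on_Omega_def)
  have fin: "finite A" using assms(2) finite_Omega by (rule finite_subset)
  have "set_lebesgue_integral Q A f = (\<integral>w. (\<Sum>v\<in>A. f v * indicator {v} w) \<partial>Q)"
    unfolding set_lebesgue_integral_def
  proof (intro Bochner_Integration.integral_cong refl)
    fix w
    show "indicator A w *\<^sub>R f w = (\<Sum>v\<in>A. f v * indicator {v} w)"
      using fin by (auto simp: indicator_def if_distrib[of "\<lambda>x. _ * x"] sum.delta cong: if_cong)
  qed
  also have "\<dots> = (\<Sum>v\<in>A. f v * measure Q {v})"
    using assms Q by (subst Bochner_Integration.integral_sum)
      (auto intro!: sum.cong prob_on_Omega_integrable[OF assms(1)] simp: Int_absorb2 subset_iff)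
  finally show ?thesis .
qed

lemma prob_on_Omega_lambda: "prob_on_Omega n (lambda_n n)"
  using prob_space_uniform_count_measure[OF finite_Omega Omega_nonempty]
  by (simp add: prob_on_Omega_def lambda_n_def space_uniform_count_measure sets_uniform_count_measure)

lemma measure_lambda_singleton:
  assumes "w \<in> Omega n" shows "measure (lambda_n n) {w} = 1 / card (Omega n)"
  using assms measure_uniform_count_measure[OF finite_Omega, of "{w}" n] by (simp add: lambda_n_def)

section \<open>Fair coin tossing is a martingale measure\<close>

text \<open>
  Reversing the move at position \<open>m\<close> is an involution of the event, and the next prices at a path
  and at its mirror image average to the current price.
\<close>

lemma sum_next_price:
  assumes avg: "averaging n p"
    and "Suc m < n"
  shows "(\<Sum>w\<in>take m -` B \<inter> Omega n. price p (Suc (Suc m)) w)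
       = (\<Sum>w\<in>take m -` B \<inter> Omega n. price p (Suc m) w)"
proof -
  let ?A = "take m -` B \<inter> Omega n"
  define flip where "flip w = w[m := - w ! m]" for w :: "real list"
  have flip: "flip w \<in> ?A" "flip (flip w) = w" if "w \<in> ?A" for w
  proof -
    have "w ! m \<in> {-1, 1}" using that assms(2) by (intro nth_Omega[of w n]) auto
    then have "flip w \<in> Omega n"
      using that set_update_subset_insert[of w m "- w ! m"] by (auto simp: flip_def Omega_def)
    then show "flip w \<in> ?A" using that by (auto simp: flip_def)
    show "flip (flip w) = w"
      using that assms(2) by (auto simp: flip_def length_Omega)
  qed
  have avg': "price p (Suc (Suc m)) w + price p (Suc (Suc m)) (flip w) = 2 * price p (Suc m) w"
    if "w \<in> ?A" for w
  proof -
    have len: "length w = n" and wm: "w ! m \<in> {-1, 1}"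
      using that assms(2) nth_Omega[of w n m] by (auto simp: length_Omega)
    have "take (Suc m) w = take m w @ [w ! m]" "take (Suc m) (flip w) = take m w @ [- w ! m]"
      using len assms(2) by (simp_all add: flip_def take_Suc_conv_app_nth)
    moreover have "take m w \<in> Omega m" using that assms(2) by (intro take_Omega[of w n]) auto
    ultimately show ?thesis
      using wm avg assms(2) by (auto simp: price_def averaging_def add.commute)
  qed
  have "(\<Sum>w\<in>?A. price p (Suc (Suc m)) (flip w)) = (\<Sum>w\<in>?A. price p (Suc (Suc m)) w)"
    using flip by (intro sum.reindex_bij_witness[of _ flip flip]) auto
  then have "2 * (\<Sum>w\<in>?A. price p (Suc (Suc m)) w)
      = (\<Sum>w\<in>?A. price p (Suc (Suc m)) w + price p (Suc (Suc m)) (flip w))"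
    by (simp add: sum.distrib)
  also have "\<dots> = 2 * (\<Sum>w\<in>?A. price p (Suc m) w)"
    using avg' by (simp add: sum_distrib_left)
  finally show ?thesis by simp
qed

lemma sum_later_price:
  assumes avg: "averaging n p"
    and "1 \<le> q" "q \<le> r" "r \<le> n" "A \<in> sets (hist_algebra n q)"
  shows "(\<Sum>w\<in>A. price p r w) = (\<Sum>w\<in>A. price p q w)"
  using assms(3,4)
proof (induction r rule: dec_induct)
  case base
  then show ?case by simp
next
  case (step r)
  define m where "m = r - 1"
  have m: "r = Suc m" "Suc m < n" using step assms(2) by (auto simp: m_def)
  have "A \<in> sets (hist_algebra n r)"
    using sets_hist_algebra_mono[OF step.hyps(1)] assms(5) by blast
  then obtain B where "A = take m -` B \<inter> Omega n" by (auto simp: sets_hist_algebra m_def)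
  then have "(\<Sum>w\<in>A. price p (Suc r) w) = (\<Sum>w\<in>A. price p r w)"
    using sum_next_price[OF avg m(2), of B] m(1) by simp
  with step show ?case by simp
qed

lemma martingale_lambda:
  assumes avg: "averaging n p"
  shows "martingale_upto n (lambda_n n) (hist_algebra n) (price p)"
proof -
  have prob: "prob_on_Omega n (lambda_n n)" by (rule prob_on_Omega_lambda)
  interpret prob_space "lambda_n n" using prob by (simp add: prob_on_Omega_def)
  have "AE w in lambda_n n. real_cond_exp (lambda_n n) (hist_algebra n q) (price p r) w = price p q w"
    if qr: "q \<in> {1..n}" "r \<in> {q..n}" for q r
  proof -
    interpret finite_measure_subalgebra "lambda_n n" "hist_algebra n q"
      by unfold_locales (rule subalgebra_hist_algebra[OF prob])
    show ?thesis
    proof (rule real_cond_exp_charact)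
      fix A assume A: "A \<in> sets (hist_algebra n q)"
      then have sub: "A \<subseteq> Omega n" by (auto simp: sets_hist_algebra)
      have "(\<Sum>w\<in>A. price p r w) = (\<Sum>w\<in>A. price p q w)"
        using qr by (intro sum_later_price[OF avg _ _ _ A]) auto
      then have "(\<Sum>w\<in>A. price p r w / card (Omega n)) = (\<Sum>w\<in>A. price p q w / card (Omega n))"
        by (simp flip: sum_divide_distrib)
      then show "set_lebesgue_integral (lambda_n n) A (price p r)
          = set_lebesgue_integral (lambda_n n) A (price p q)"
        using sub by (simp add: prob_on_Omega_set_integral[OF prob] measure_lambda_singleton subset_iff
            cong: sum.cong)
    qed (simp_all add: prob_on_Omega_integrable[OF prob] price_hist_measurable)
  qed
  then show ?thesis
    using prob unfolding martingale_upto_def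
    by (auto simp: prob_on_Omega_def filtration_hist_algebra subalgebra_hist_algebra[OF prob]
        price_hist_measurable prob_on_Omega_integrable[OF prob])
qed

section \<open>Uniqueness of the martingale measure\<close>

lemma martingale_set_integral:
  assumes prob: "prob_on_Omega n Q" and mart: "martingale_upto n Q (hist_algebra n) Y"
    and qr: "q \<in> {1..n}" "r \<in> {q..n}" and A: "A \<in> sets (hist_algebra n q)"
  shows "(\<Sum>w\<in>A. Y r w * measure Q {w}) = (\<Sum>w\<in>A. Y q w * measure Q {w})"
proof -
  interpret prob_space Q using prob by (simp add: prob_on_Omega_def)
  interpret finite_measure_subalgebra Q "hist_algebra n q"
    by unfold_locales (rule subalgebra_hist_algebra[OF prob])
  have sub: "A \<subseteq> Omega n" using A by (auto simp: sets_hist_algebra)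
  have AQ: "A \<in> sets Q" using sub prob by (auto simp: prob_on_Omega_def)
  have "set_lebesgue_integral Q A (Y r) = set_lebesgue_integral Q A (real_cond_exp Q (hist_algebra n q) (Y r))"
    using A by (intro real_cond_exp_intA prob_on_Omega_integrable[OF prob])
  also have "\<dots> = set_lebesgue_integral Q A (Y q)"
  proof (rule set_lebesgue_integral_cong_AE[OF AQ])
    have "AE w in Q. real_cond_exp Q (hist_algebra n q) (Y r) w = Y q w"
      using mart qr by (auto simp: martingale_upto_def)
    then show "AE w in Q. w \<in> A \<longrightarrow> real_cond_exp Q (hist_algebra n q) (Y r) w = Y q w"
      by eventually_elim simp
  qed (use prob_on_Omega_integrable[OF prob] in auto)
  finally show ?thesis by (simp add: prob_on_Omega_set_integral[OF prob sub])
qed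

definition cylinder :: "nat \<Rightarrow> real list \<Rightarrow> real list set" where
  "cylinder n v = take (length v) -` {v} \<inter> Omega n"

lemma cylinder_split:
  assumes "m < n" "v \<in> Omega m"
  shows "cylinder n v = cylinder n (v @ [1]) \<union> cylinder n (v @ [-1])" "cylinder n (v @ [1]) \<inter> cylinder n (v @ [-1]) = {}"
proof -
  have *: "take (Suc m) w = take m w @ [w ! m] \<and> w ! m \<in> {-1, 1}" if "w \<in> Omega n" for w
    using that assms nth_Omega[of w n m] by (auto simp: length_Omega take_Suc_conv_app_nth)
  show "cylinder n v = cylinder n (v @ [1]) \<union> cylinder n (v @ [-1])" "cylinder n (v @ [1]) \<inter> cylinder n (v @ [-1]) = {}"
    using assms * by (auto simp: cylinder_def length_Omega)
qed

text \<open>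
  The martingale equation on the cylinder of \<open>v'\<close> reads \<open>p (v'+) * c 1 + p (v'-) * c (-1) =
  p v' * (c 1 + c (-1))\<close>, with \<open>c s\<close> the mass of the cylinder of \<open>v' @ [s]\<close>. As \<open>p v'\<close> is the
  average of \<open>p (v'+)\<close> and \<open>p (v'-)\<close> and these differ, both halves have the same mass.
\<close>

lemma martingale_cylinder:
  assumes prob: "prob_on_Omega n Q" and mart: "martingale_upto n Q (hist_algebra n) (price p)"
    and avg: "averaging n p"
    and strict: "strictly_increasing n p"
    and "m < n" "v \<in> Omega m"
  shows "(\<Sum>w\<in>cylinder n v. measure Q {w}) = 1 / 2 ^ m"
  using assms(5,6)
proof (induction m arbitrary: v)
  case 0
  interpret prob_space Q using prob by (simp add: prob_on_Omega_def)
  have Q: "space Q = Omega n" "sets Q = Pow (Omega n)"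
    using prob by (auto simp: prob_on_Omega_def)
  have "cylinder n v = Omega n" using 0 by (auto simp: cylinder_def Omega_def)
  moreover have "measure Q (Omega n) = (\<Sum>w\<in>Omega n. measure Q {w})"
    using Q by (intro finite_measure_eq_sum_singleton finite_Omega) auto
  ultimately show ?case using prob_space Q by simp
next
  case (Suc m)
  obtain v' u where v: "v = v' @ [u]" "v' \<in> Omega m" "u \<in> {-1, 1}"
    using Suc.prems by (cases v rule: rev_exhaust) (auto simp: Omega_def)
  define c where "c s = (\<Sum>w\<in>cylinder n (v' @ [s]). measure Q {w})" for s
  have fin: "finite (cylinder n v)" for v by (simp add: cylinder_def finite_Omega)
  note split = cylinder_split[OF Suc_lessD[OF Suc.prems(1)] v(2)]
  have on_cyl: "take m w = v'" if "w \<in> cylinder n v'" for w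
    using that v(2) by (simp add: cylinder_def length_Omega)
  have on_cyl': "take (Suc m) w = v' @ [s]" if "w \<in> cylinder n (v' @ [s])" for w s
    using that v(2) by (simp add: cylinder_def length_Omega)
  have total: "c 1 + c (-1) = (\<Sum>w\<in>cylinder n v'. measure Q {w})"
    unfolding c_def split(1) using split(2) by (intro sum.union_disjoint[symmetric] fin)
  have "cylinder n v' \<in> sets (hist_algebra n (Suc m))"
    using v(2) by (auto simp: sets_hist_algebra cylinder_def length_Omega)
  then have "(\<Sum>w\<in>cylinder n v'. price p (Suc (Suc m)) w * measure Q {w})
      = (\<Sum>w\<in>cylinder n v'. price p (Suc m) w * measure Q {w})"
    using Suc.prems by (intro martingale_set_integral[OF prob mart]) auto
  also have "\<dots> = (\<Sum>w\<in>cylinder n v'. p (Suc m) v' * measure Q {w})"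
    by (intro sum.cong) (auto simp: price_def on_cyl)
  also have "\<dots> = p (Suc m) v' * (c 1 + c (-1))"
    by (simp add: total sum_distrib_left)
  also have "(\<Sum>w\<in>cylinder n v'. price p (Suc (Suc m)) w * measure Q {w})
      = (\<Sum>w\<in>cylinder n (v' @ [1]). price p (Suc (Suc m)) w * measure Q {w})
      + (\<Sum>w\<in>cylinder n (v' @ [-1]). price p (Suc (Suc m)) w * measure Q {w})"
    unfolding split(1) using split(2) by (intro sum.union_disjoint fin)
  also have "\<dots> = p (Suc (Suc m)) (v' @ [1]) * c 1 + p (Suc (Suc m)) (v' @ [-1]) * c (-1)"
    unfolding c_def sum_distrib_left
    by (intro arg_cong2[of _ _ _ _ "(+)"] sum.cong) (auto simp: price_def on_cyl')
  finally have "2 * (p (Suc (Suc m)) (v' @ [1]) * c 1 + p (Suc (Suc m)) (v' @ [-1]) * c (-1))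
      = (2 * p (Suc m) v') * (c 1 + c (-1))" by simp
  also have "2 * p (Suc m) v' = p (Suc (Suc m)) (v' @ [1]) + p (Suc (Suc m)) (v' @ [-1])"
    using avg Suc.prems(1) v(2) by (simp add: averaging_def)
  finally have "(p (Suc (Suc m)) (v' @ [1]) - p (Suc (Suc m)) (v' @ [-1])) * (c 1 - c (-1)) = 0"
    by (simp add: algebra_simps)
  then have eq: "c 1 = c (-1)"
    using strict Suc.prems(1) v(2) by (fastforce simp: strictly_increasing_def)
  have "c 1 + c (-1) = 1 / 2 ^ m"
    using Suc.IH[OF Suc_lessD[OF Suc.prems(1)] v(2)] total by simp
  with eq v(3) have "c u = 1 / 2 ^ Suc m" by auto
  then show ?case by (simp add: c_def v(1))
qed

lemma cylinders_determine_hist: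
  assumes "prob_on_Omega n Q" "prob_on_Omega n R" "n \<ge> 1"
    and cyl: "\<And>v. v \<in> Omega (n - 1) \<Longrightarrow>
      (\<Sum>w\<in>cylinder n v. measure Q {w}) = (\<Sum>w\<in>cylinder n v. measure R {w})"
    and A: "A \<in> sets (hist_algebra n n)"
  shows "measure Q A = measure R A"
proof -
  obtain B where B: "A = take (n - 1) -` B \<inter> Omega n" using A by (auto simp: sets_hist_algebra)
  have fin: "finite A" unfolding B by (simp add: finite_Omega)
  have decomp: "measure M A = (\<Sum>v\<in>B \<inter> Omega (n - 1). \<Sum>w\<in>cylinder n v. measure M {w})"
    if M: "prob_on_Omega n M" for M
  proof -
    interpret prob_space M using M by (simp add: prob_on_Omega_def)
    have "measure M A = (\<Sum>w\<in>A. measure M {w})"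
      using M B by (intro finite_measure_eq_sum_singleton fin) (auto simp: prob_on_Omega_def)
    also have "\<dots> = (\<Sum>v\<in>B \<inter> Omega (n - 1). \<Sum>w | w \<in> A \<and> take (n - 1) w = v. measure M {w})"
      using fin finite_Omega B by (intro sum.group[symmetric]) (auto intro: take_Omega)
    also have "\<dots> = (\<Sum>v\<in>B \<inter> Omega (n - 1). \<Sum>w\<in>cylinder n v. measure M {w})"
      unfolding B by (intro sum.cong refl) (auto simp: cylinder_def length_Omega)
    finally show ?thesis .
  qed
  show ?thesis
    unfolding decomp[OF assms(1)] decomp[OF assms(2)] by (rule sum.cong) (simp_all add: cyl)
qed

theorem theorem16:
  fixes n :: nat and \<mu> :: "real measure" and H :: "real \<Rightarrow> real"
    and P :: "(real list \<times> real) measure" and X :: "real list \<Rightarrow> real"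
    and p :: "nat \<Rightarrow> real list \<Rightarrow> real"
  assumes "n \<ge> 1"
    and "law_assumption \<mu>"
    and "risk_assumption H"
    and "nash_equilibrium n \<mu> H P X"
    and "\<forall>w\<in>Omega n. X w = X_of n p w"
  shows "prob_on_Omega n (lambda_n n) \<and>
    martingale_upto n (lambda_n n) (hist_algebra n) (price p) \<and>
    (\<forall>Q. prob_on_Omega n Q \<and> martingale_upto n Q (hist_algebra n) (price p) \<longrightarrow>
      (\<forall>A\<in>sets (hist_algebra n n). measure Q A = measure (lambda_n n) A))"
proof -
  have H: "strict_mono H" using assms(3) by (simp add: risk_assumption_def)
  note exch = equilibrium_exchangeable[OF assms(1,2) H assms(4,5)]
  note conv = equilibrium_convex[OF assms(1,2) H assms(4,5)]
  have avg: "averaging n p"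
    using exch by (rule exchangeable_imp_averaging)
  have strict: "strictly_increasing n p"
    using exch conv by (rule convex_imp_strictly_increasing)
  have lambda: "prob_on_Omega n (lambda_n n)" by (rule prob_on_Omega_lambda)
  have mart: "martingale_upto n (lambda_n n) (hist_algebra n) (price p)"
    using avg by (rule martingale_lambda)
  have "measure Q A = measure (lambda_n n) A"
    if Q: "prob_on_Omega n Q" "martingale_upto n Q (hist_algebra n) (price p)"
      and A: "A \<in> sets (hist_algebra n n)" for Q A
  proof (rule cylinders_determine_hist[OF Q(1) lambda assms(1) _ A])
    fix v assume v: "v \<in> Omega (n - 1)"
    have "n - 1 < n" using assms(1) by simp
    then show "(\<Sum>w\<in>cylinder n v. measure Q {w}) = (\<Sum>w\<in>cylinder n v. measure (lambda_n n) {w})"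
      using martingale_cylinder[OF Q avg strict _ v] martingale_cylinder[OF lambda mart avg strict _ v]
      by simp
  qed
  with lambda mart show ?thesis by blast
qed

end
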